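(* Let $q\in\mathbb{C}$ with $|q|<1$, let $r$ be a positive integer, $w_1,\dots,w_r\in\mathbb{C}$, $x\in\mathbb{C}$, and $k$ a nonnegative integer. Then $\zeta_{r,q}(w_1,\dots,w_r\mid -k,x)=E_{k,q}(w_1,\dots,w_r\mid x)$, i.e. $$[2]_q^r\sum_{n_1,\dots,n_r=0}^{\infty}(-1)^{n_1+\cdots+n_r}q^{n_1+\cdots+n_r}\,(n_1w_1+\cdots+n_rw_r+x)^k=E_{k,q}(w_1,\dots,w_r\mid x).$$
   Context: Write $[2]_q=1+q$. The multiple $q$-Euler polynomials of Barnes type $E_{n,q}(w_1,\dots,w_r\mid x)$ are defined by the Taylor expansion at $t=0$ $$\frac{[2]_q^r\,e^{xt}}{(qe^{w_1t}+1)(qe^{w_2t}+1)\cdots(qe^{w_rt}+1)}=\sum_{n=0}^{\infty}E_{n,q}(w_1,\dots,w_r\mid x)\frac{t^n}{n!}.$$ The Barnes-type multiple $q$-Euler zeta function is $$\zeta_{r,q}(w_1,\dots,w_r\mid s,x)=[2]_q^r\sum_{n_1,\dots,n_r=0}^{\infty}\frac{(-1)^{n_1+\cdots+n_r}q^{n_1+\cdots+n_r}}{(n_1w_1+\cdots+n_rw_r+x)^s},$$ so that at $s=-k$ the summand is $(-1)^{\sum n_i}q^{\sum n_i}(\sum n_iw_i+x)^k$. *)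

theory Defs
  imports "HOL-Complex_Analysis.Complex_Analysis"
begin

definition barnes_q_euler_gf ::
  "complex \<Rightarrow> nat \<Rightarrow> (nat \<Rightarrow> complex) \<Rightarrow> complex \<Rightarrow> complex \<Rightarrow> complex" where
  "barnes_q_euler_gf q r w x t =
     (1 + q) ^ r * exp (x * t) / (\<Prod>i=1..r. q * exp (w i * t) + 1)"

definition barnes_q_euler ::
  "nat \<Rightarrow> complex \<Rightarrow> nat \<Rightarrow> (nat \<Rightarrow> complex) \<Rightarrow> complex \<Rightarrow> complex" where
  "barnes_q_euler n q r w x =
     fact n * fps_nth (fps_expansion (barnes_q_euler_gf q r w x) 0) n"

lemma barnes_q_euler_taylor:
  fixes q x :: complex and w :: "nat \<Rightarrow> complex"
  assumes "q \<noteq> -1"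
  shows "\<forall>\<^sub>F t in nhds 0.
           (\<lambda>n. barnes_q_euler n q r w x * t ^ n / fact n) sums barnes_q_euler_gf q r w x t"
proof -
  have nz: "q + 1 \<noteq> 0"
    using assms by (simp add: add_eq_0_iff2)
  have "barnes_q_euler_gf q r w x analytic_on {0}"
    unfolding barnes_q_euler_gf_def [abs_def]
    by (intro analytic_intros) (use nz in auto)
  then have *: "barnes_q_euler_gf q r w x has_fps_expansion
                  fps_expansion (barnes_q_euler_gf q r w x) 0"
    by (rule analytic_at_imp_has_fps_expansion_0)
  have "\<forall>\<^sub>F t in nhds 0. t \<in> eball 0 (fps_conv_radius (fps_expansion (barnes_q_euler_gf q r w x) 0))"
    by (rule eventually_nhds_in_open)
       (use * in \<open>auto simp: has_fps_expansion_def zero_ereal_def\<close>)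
  moreover have "\<forall>\<^sub>F t in nhds 0.
      eval_fps (fps_expansion (barnes_q_euler_gf q r w x) 0) t = barnes_q_euler_gf q r w x t"
    using * by (simp add: has_fps_expansion_def)
  ultimately show ?thesis
  proof eventually_elim
    case (elim t)
    from elim(1) have "ereal (norm t) < fps_conv_radius (fps_expansion (barnes_q_euler_gf q r w x) 0)"
      by (auto simp: in_eball_iff)
    from sums_eval_fps [OF this] show ?case
      using elim(2) by (simp add: barnes_q_euler_def)
  qed
qed

(* Principal-branch power with 0^0 = 1, whereas 0 powr 0 = 0. *)
definition cpow :: "complex \<Rightarrow> complex \<Rightarrow> complex" where
  "cpow z s = (if s = 0 then 1 else z powr s)"

lemma cpow_of_nat: "cpow z (of_nat k) = z ^ k"
  by (cases "z = 0") (auto simp: cpow_def powr_nat)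

(* The factor 1 / z^s is written z^(-s), so that at s = -k it is z^k also when z = 0. *)
definition barnes_q_zeta_term ::
  "complex \<Rightarrow> nat \<Rightarrow> (nat \<Rightarrow> complex) \<Rightarrow> complex \<Rightarrow> complex \<Rightarrow> (nat \<Rightarrow> nat) \<Rightarrow> complex" where
  "barnes_q_zeta_term q r w s x n =
     (- 1) ^ (\<Sum>i=1..r. n i) * q ^ (\<Sum>i=1..r. n i) *
     cpow ((\<Sum>i=1..r. of_nat (n i) * w i) + x) (- s)"

definition barnes_q_zeta ::
  "complex \<Rightarrow> nat \<Rightarrow> (nat \<Rightarrow> complex) \<Rightarrow> complex \<Rightarrow> complex \<Rightarrow> complex" where
  "barnes_q_zeta q r w s x =
     (1 + q) ^ r *
     (\<Sum>\<^sub>\<infinity>n\<in>{1..r} \<rightarrow>\<^sub>E (UNIV :: nat set). barnes_q_zeta_term q r w s x n)"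

end

theory Submission
  imports Defs
begin

text \<open>
  For small \<open>t\<close> the double series of \<open>(- q)\<^bsup>|n|\<^esup> (n\<cdot>w + x)\<^sup>m t\<^sup>m / m!\<close> over multi-indices \<open>n\<close> and
  degrees \<open>m\<close> converges absolutely, since it is dominated by a product of geometric series with
  ratios \<open>|q| exp (|w\<^sub>i| |t|) < 1\<close>. Summing over \<open>m\<close> first gives exponentials, and the remaining
  sum over \<open>n\<close> factors into geometric series whose product is the generating function divided by
  \<open>(1 + q)\<^sup>r\<close>. Summing over \<open>n\<close> first gives a power series in \<open>t\<close> whose coefficients are
  the zeta values. The theorem follows by uniqueness of Taylor coefficients.
\<close>

text \<open>Each factor is an absolutely convergent geometric series, and a finite product of such
  series may be expanded over all multi-indices. The field is left general because real ratios are
  needed for the majorant and complex ratios for the generating function.\<close>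

lemma
  fixes c :: "'a \<Rightarrow> 'b :: {real_normed_field, banach, second_countable_topology}"
  assumes fin: "finite A" and c: "\<And>i. i \<in> A \<Longrightarrow> norm (c i) < 1"
  shows norm_summable_on_prod_power_PiE:
          "(\<lambda>n. norm (\<Prod>i\<in>A. c i ^ n i)) summable_on (A \<rightarrow>\<^sub>E (UNIV :: nat set))" (is ?summable)
    and has_sum_prod_power_PiE:
          "((\<lambda>n. \<Prod>i\<in>A. c i ^ n i) has_sum (\<Prod>i\<in>A. 1 / (1 - c i))) (A \<rightarrow>\<^sub>E (UNIV :: nat set))"
proof -
  have summable1: "(\<lambda>n. norm (c i ^ n)) summable_on UNIV" if "i \<in> A" for i
    using c[OF that]
    by (intro summable_nonneg_imp_summable_on) (auto simp: norm_power intro: summable_geometric)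
  have infsum1: "(\<Sum>\<^sub>\<infinity>n. c i ^ n) = 1 / (1 - c i)" if "i \<in> A" for i
    using c[OF that]
    by (intro infsumI norm_summable_imp_has_sum geometric_sums)
       (auto simp: norm_power intro: summable_geometric)
  show ?summable
    unfolding abs_summable_equivalent using summable1
    by (intro abs_summable_on_prod_PiE fin) (auto simp flip: abs_summable_equivalent)
  moreover have "(\<Sum>\<^sub>\<infinity>n\<in>A \<rightarrow>\<^sub>E UNIV. \<Prod>i\<in>A. c i ^ n i) = (\<Prod>i\<in>A. 1 / (1 - c i))"
    using summable1 by (subst infsum_prod_PiE_abs) (auto simp: fin infsum1)
  ultimately show "((\<lambda>n. \<Prod>i\<in>A. c i ^ n i) has_sum (\<Prod>i\<in>A. 1 / (1 - c i))) (A \<rightarrow>\<^sub>E UNIV)"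
    by (metis abs_summable_summable has_sum_infsum)
qed

lemma has_sum_exp_series:
  fixes a b :: "'a :: {real_normed_field, banach}"
  shows "((\<lambda>m. a ^ m * b ^ m / fact m) has_sum exp (a * b)) UNIV"
proof (rule norm_summable_imp_has_sum)
  have eq: "a ^ m * b ^ m / fact m = (a * b) ^ m /\<^sub>R fact m" for m
    by (simp add: scaleR_conv_of_real power_mult_distrib field_simps)
  show "(\<lambda>m. a ^ m * b ^ m / fact m) sums exp (a * b)"
    unfolding eq by (rule exp_converges)
  show "summable (\<lambda>m. norm (a ^ m * b ^ m / fact m))"
    unfolding eq by (rule summable_norm_exp)
qed

context
  fixes q x :: complex and r :: nat and w :: "nat \<Rightarrow> complex" and t :: complex
  assumes small: "\<And>i. i \<in> {1..r} \<Longrightarrow> norm q * exp (norm (w i) * norm t) < 1"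
begin

text \<open>Summing the norms over \<open>m\<close> gives \<open>exp (norm (z n) * norm t)\<close>.
  The triangle inequality bounds \<open>norm (z n)\<close> by an expression affine in the
  \<open>n i\<close>, so the exponential is dominated by a constant times a product of geometric
  terms, whose ratios are below 1 by \<open>small\<close>.\<close>

lemma summable_on_barnes_double_series:
  "(\<lambda>(n, m). (- q) ^ (\<Sum>i=1..r. n i) *
       (((\<Sum>i=1..r. of_nat (n i) * w i) + x) ^ m * t ^ m / fact m))
     summable_on ({1..r} \<rightarrow>\<^sub>E (UNIV :: nat set)) \<times> (UNIV :: nat set)"
proof -
  define z where "z n = (\<Sum>i=1..r. of_nat (n i) * w i) + x" for n :: "nat \<Rightarrow> nat"
  define f where "f = (\<lambda>(n, m). (- q) ^ (\<Sum>i=1..r. n i) * (z n ^ m * t ^ m / fact m))"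
  have inner: "((\<lambda>m. norm (f (n, m))) has_sum
                 norm q ^ (\<Sum>i=1..r. n i) * exp (norm (z n) * norm t)) UNIV" for n
    using has_sum_cmult_right[OF has_sum_exp_series[of "norm (z n)" "norm t"],
        of "norm q ^ (\<Sum>i=1..r. n i)"]
    by (simp add: f_def norm_mult norm_divide norm_power)
  \<comment> \<open>All factors of the product are nonnegative; the outer \<open>norm\<close> only
    matches the form of \<open>norm_summable_on_prod_power_PiE\<close>.\<close>
  have bound: "norm q ^ (\<Sum>i=1..r. n i) * exp (norm (z n) * norm t)
          \<le> exp (norm x * norm t) * norm (\<Prod>i=1..r. (norm q * exp (norm (w i) * norm t)) ^ n i)" for n
  proof -
    have "norm (z n) \<le> (\<Sum>i=1..r. real (n i) * norm (w i)) + norm x"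
      unfolding z_def
      by (intro order.trans[OF norm_triangle_ineq] add_mono order.trans[OF norm_sum])
         (auto simp: norm_mult)
    then have "norm (z n) * norm t
                 \<le> ((\<Sum>i=1..r. real (n i) * norm (w i)) + norm x) * norm t"
      by (intro mult_right_mono) auto
    also have "\<dots> = norm x * norm t + (\<Sum>i=1..r. real (n i) * (norm (w i) * norm t))"
      by (simp add: algebra_simps sum_distrib_left)
    finally have "exp (norm (z n) * norm t)
        \<le> exp (norm x * norm t + (\<Sum>i=1..r. real (n i) * (norm (w i) * norm t)))"
      by simp
    also have "\<dots> = exp (norm x * norm t) * (\<Prod>i=1..r. exp (norm (w i) * norm t) ^ n i)"
      by (simp add: exp_add exp_sum exp_of_nat_mult)
    finally have "exp (norm (z n) * norm t)
        \<le> exp (norm x * norm t) * (\<Prod>i=1..r. exp (norm (w i) * norm t) ^ n i)" .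
    then have "norm q ^ (\<Sum>i=1..r. n i) * exp (norm (z n) * norm t)
        \<le> norm q ^ (\<Sum>i=1..r. n i) *
            (exp (norm x * norm t) * (\<Prod>i=1..r. exp (norm (w i) * norm t) ^ n i))"
      by (intro mult_left_mono) auto
    then show ?thesis
      by (simp add: power_sum power_mult_distrib prod.distrib abs_mult abs_prod mult_ac)
  qed
  have "(\<lambda>n. exp (norm x * norm t) * norm (\<Prod>i=1..r. (norm q * exp (norm (w i) * norm t)) ^ n i))
          summable_on ({1..r} \<rightarrow>\<^sub>E UNIV)"
    using small
    by (intro summable_on_cmult_right norm_summable_on_prod_power_PiE) auto
  then have "(\<lambda>n. norm q ^ (\<Sum>i=1..r. n i) * exp (norm (z n) * norm t))
               summable_on ({1..r} \<rightarrow>\<^sub>E UNIV)"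
    by (rule summable_on_comparison_test) (use bound in auto)
  \<comment> \<open>Tonelli criterion: the inner sums of norms exist by \<open>inner\<close>, and
    their values are summable over \<open>n\<close>.\<close>
  then have "(\<lambda>p. norm (f p)) summable_on ({1..r} \<rightarrow>\<^sub>E UNIV) \<times> UNIV"
    using inner
    by (subst Infinite_Sum.abs_summable_on_Sigma_iff)
       (auto simp: summable_on_def infsumI[OF inner] cong: has_sum_cong)
  then show ?thesis
    using abs_summable_summable unfolding f_def z_def by blast
qed

text \<open>The conclusion does not involve \<open>t\<close>: a single nonzero admissible
  \<open>t\<close> serves as a witness for every \<open>m\<close>. The family is the slice of the
  double series at degree \<open>m\<close>, with the nonzero factor \<open>t ^ m / fact m\<close>
  divided out.\<close>

lemma barnes_summand_summable_on:
  assumes "t \<noteq> 0"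
  shows "(\<lambda>n. (- q) ^ (\<Sum>i=1..r. n i) * ((\<Sum>i=1..r. of_nat (n i) * w i) + x) ^ m)
           summable_on ({1..r} \<rightarrow>\<^sub>E (UNIV :: nat set))"
proof -
  have "(\<lambda>n. (- q) ^ (\<Sum>i=1..r. n i) *
          (((\<Sum>i=1..r. of_nat (n i) * w i) + x) ^ m * t ^ m / fact m))
          summable_on ({1..r} \<rightarrow>\<^sub>E (UNIV :: nat set))"
    \<comment> \<open>The swap makes \<open>m\<close> the outer index, so that fixing it leaves a
      sum over \<open>n\<close>.\<close>
    using summable_on_barnes_double_series[THEN summable_on_swap[THEN iffD1]]
    unfolding prod.case by (rule summable_on_SigmaD1) simp
  from summable_on_cmult_left[OF this, of "fact m / t ^ m"] show ?thesis
    using assms by (simp add: field_simps)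
qed

text \<open>Both orders of summation of the double series are evaluated and compared. Summability is
  a hypothesis here because \<open>t = 0\<close> must be covered too, where
  \<open>barnes_summand_summable_on\<close> does not apply.\<close>

lemma barnes_series_sums_gf:
  assumes summable: "\<And>m. (\<lambda>n. (- q) ^ (\<Sum>i=1..r. n i) *
            ((\<Sum>i=1..r. of_nat (n i) * w i) + x) ^ m) summable_on ({1..r} \<rightarrow>\<^sub>E (UNIV :: nat set))"
  shows "(\<lambda>m. (1 + q) ^ r *
            (\<Sum>\<^sub>\<infinity>n\<in>{1..r} \<rightarrow>\<^sub>E (UNIV :: nat set). (- q) ^ (\<Sum>i=1..r. n i) *
               ((\<Sum>i=1..r. of_nat (n i) * w i) + x) ^ m) / fact m * t ^ m)
         sums barnes_q_euler_gf q r w x t"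
proof -
  define z where "z n = (\<Sum>i=1..r. of_nat (n i) * w i) + x" for n :: "nat \<Rightarrow> nat"
  define f where "f = (\<lambda>(n, m). (- q) ^ (\<Sum>i=1..r. n i) * (z n ^ m * t ^ m / fact m))"
  define A where "A = ({1..r} \<rightarrow>\<^sub>E (UNIV :: nat set))"
  define S where "S m = (\<Sum>\<^sub>\<infinity>n\<in>A. (- q) ^ (\<Sum>i=1..r. n i) * z n ^ m)" for m
  have f: "(f has_sum infsum f (A \<times> UNIV)) (A \<times> UNIV)"
    using summable_on_barnes_double_series
    unfolding f_def z_def A_def by (intro has_sum_infsum)
  have "((\<lambda>m. f (n, m)) has_sum (- q) ^ (\<Sum>i=1..r. n i) * exp (z n * t)) UNIV" for n
    unfolding f_def prod.case by (intro has_sum_cmult_right has_sum_exp_series)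
  \<comment> \<open>First order of summation: \<open>m\<close> inside, \<open>n\<close>
    outside.\<close>
  from has_sum_SigmaD[OF f this]
  have 1: "((\<lambda>n. (- q) ^ (\<Sum>i=1..r. n i) * exp (z n * t)) has_sum infsum f (A \<times> UNIV)) A" .
  have "(- q) ^ (\<Sum>i=1..r. n i) * exp (z n * t)
          = exp (x * t) * (\<Prod>i=1..r. (- q * exp (w i * t)) ^ n i)" for n
  proof -
    have "z n * t = x * t + (\<Sum>i=1..r. of_nat (n i) * (w i * t))"
      by (simp add: z_def algebra_simps sum_distrib_left)
    then have "exp (z n * t) = exp (x * t) * (\<Prod>i=1..r. exp (w i * t) ^ n i)"
      by (simp add: exp_add exp_sum exp_of_nat_mult)
    then show ?thesis
      by (simp only: power_sum power_mult_distrib prod.distrib mult_ac)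
  qed
  \<comment> \<open>The complex ratios are bounded in norm by the real ratios of
    \<open>small\<close>.\<close>
  moreover have "norm (- q * exp (w i * t)) < 1" if "i \<in> {1..r}" for i
  proof -
    have "norm (exp (w i * t)) \<le> exp (norm (w i) * norm t)"
      by (metis norm_exp norm_mult)
    then show ?thesis
      using small[OF that] mult_left_mono[of "norm (exp (w i * t))" _ "norm q"]
      by (fastforce simp: norm_mult)
  qed
  ultimately have "((\<lambda>n. (- q) ^ (\<Sum>i=1..r. n i) * exp (z n * t)) has_sum
                      exp (x * t) * (\<Prod>i=1..r. 1 / (1 - (- q * exp (w i * t))))) A"
    unfolding A_def
    by (simp only:) (intro has_sum_cmult_right has_sum_prod_power_PiE, auto)
  from has_sum_unique[OF 1 this]
  have gf: "(1 + q) ^ r * infsum f (A \<times> UNIV) = barnes_q_euler_gf q r w x t"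
    by (simp add: barnes_q_euler_gf_def prod_dividef add.commute)
  \<comment> \<open>Second order of summation: \<open>n\<close> inside, \<open>m\<close>
    outside.\<close>
  have "((\<lambda>n. f (n, m)) has_sum S m * (t ^ m / fact m)) A" for m
    using has_sum_cmult_left[OF has_sum_infsum[OF summable[of m]], of "t ^ m / fact m"]
    by (simp add: f_def S_def A_def z_def mult.assoc)
  then have "((\<lambda>m. S m * (t ^ m / fact m)) has_sum infsum f (A \<times> UNIV)) UNIV"
    using f[THEN has_sum_swap[THEN iffD1]] by (auto intro: has_sum_SigmaD)
  then have "(\<lambda>m. (1 + q) ^ r * (S m * (t ^ m / fact m))) sums barnes_q_euler_gf q r w x t"
    unfolding gf[symmetric] by (intro sums_mult has_sum_imp_sums)
  then show ?thesis
    by (simp add: S_def A_def z_def mult.assoc)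
qed

end

theorem theorem3:
  fixes q x :: complex and r k :: nat and w :: "nat \<Rightarrow> complex"
  assumes "norm q < 1" and "r \<ge> 1"
  shows "(\<lambda>n. (- 1) ^ (\<Sum>i=1..r. n i) * q ^ (\<Sum>i=1..r. n i) *
              ((\<Sum>i=1..r. of_nat (n i) * w i) + x) ^ k)
           summable_on ({1..r} \<rightarrow>\<^sub>E (UNIV :: nat set)) \<and>
         barnes_q_zeta q r w (- of_nat k) x = barnes_q_euler k q r w x \<and>
         (1 + q) ^ r *
           (\<Sum>\<^sub>\<infinity>n\<in>{1..r} \<rightarrow>\<^sub>E (UNIV :: nat set).
              (- 1) ^ (\<Sum>i=1..r. n i) * q ^ (\<Sum>i=1..r. n i) *
              ((\<Sum>i=1..r. of_nat (n i) * w i) + x) ^ k)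
           = barnes_q_euler k q r w x"
proof -
  \<comment> \<open>At \<open>t = 0\<close> the left-hand side is \<open>norm q\<close>, so
    continuity keeps it below 1 nearby.\<close>
  have "\<forall>\<^sub>F t::complex in nhds 0. norm q * exp (norm (w i) * norm t) < 1" for i
  proof (rule order_tendstoD(2))
    have "isCont (\<lambda>t::complex. norm q * exp (norm (w i) * norm t)) 0"
      by (intro continuous_intros)
    then show "((\<lambda>t::complex. norm q * exp (norm (w i) * norm t)) \<longlongrightarrow> norm q) (nhds 0)"
      using tendsto_at_iff_tendsto_nhds[of "\<lambda>t::complex. norm q * exp (norm (w i) * norm t)" 0]
      by (simp add: isCont_def)
  qed (fact assms(1))
  then have small: "\<forall>\<^sub>F t::complex in nhds 0. \<forall>i\<in>{1..r}. norm q * exp (norm (w i) * norm t) < 1"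
    by (intro eventually_ball_finite) auto
  \<comment> \<open>The punctured neighbourhood supplies the nonzero \<open>t\<close> needed for
    summability; the full one is kept for the power series expansion.\<close>
  then have "\<forall>\<^sub>F t::complex in at 0. \<forall>i\<in>{1..r}. norm q * exp (norm (w i) * norm t) < 1"
    by (simp add: eventually_at_filter eventually_mono)
  then have "\<forall>\<^sub>F t::complex in at 0. t \<noteq> 0 \<and> (\<forall>i\<in>{1..r}. norm q * exp (norm (w i) * norm t) < 1)"
    by (simp add: eventually_conj_iff eventually_neq_at_within)
  then obtain t :: complex
    where t: "t \<noteq> 0" "\<And>i. i \<in> {1..r} \<Longrightarrow> norm q * exp (norm (w i) * norm t) < 1"
    using eventually_happens'[OF at_neq_bot] by blast
  have summable: "(\<lambda>n. (- q) ^ (\<Sum>i=1..r. n i) * ((\<Sum>i=1..r. of_nat (n i) * w i) + x) ^ m)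
                    summable_on ({1..r} \<rightarrow>\<^sub>E (UNIV :: nat set))" for m
    using t by (intro barnes_summand_summable_on)
  define F where "F = Abs_fps (\<lambda>m. (1 + q) ^ r *
            (\<Sum>\<^sub>\<infinity>n\<in>{1..r} \<rightarrow>\<^sub>E (UNIV :: nat set). (- q) ^ (\<Sum>i=1..r. n i) *
               ((\<Sum>i=1..r. of_nat (n i) * w i) + x) ^ m) / fact m)"
  have "barnes_q_euler_gf q r w x has_fps_expansion F"
  proof (rule has_fps_expansionI)
    show "\<forall>\<^sub>F t in nhds 0. (\<lambda>m. fps_nth F m * t ^ m) sums barnes_q_euler_gf q r w x t"
      using small
    proof eventually_elim
      case (elim t)
      then show ?case
        unfolding F_def fps_nth_Abs_fps
        by (intro barnes_series_sums_gf summable) auto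
    qed
  qed
  \<comment> \<open>Uniqueness of Taylor coefficients at 0.\<close>
  then have "fps_expansion (barnes_q_euler_gf q r w x) 0 = F"
    by (rule fps_expansion_eqI)
  then have euler: "barnes_q_euler k q r w x = (1 + q) ^ r *
            (\<Sum>\<^sub>\<infinity>n\<in>{1..r} \<rightarrow>\<^sub>E (UNIV :: nat set). (- q) ^ (\<Sum>i=1..r. n i) *
               ((\<Sum>i=1..r. of_nat (n i) * w i) + x) ^ k)"
    by (simp add: barnes_q_euler_def F_def)
  have sign: "(- 1) ^ m * q ^ m = (- q) ^ m" for m
    by (simp flip: power_mult_distrib)
  show ?thesis
    \<comment> \<open>By \<open>cpow_of_nat\<close>, the exponent \<open>- (- of_nat k)\<close>
      gives the ordinary \<open>k\<close>-th power, also at base 0.\<close>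
    using summable euler
    by (simp add: barnes_q_zeta_def barnes_q_zeta_term_def cpow_of_nat sign)
qed

end
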